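(* Let $q$ be a power of an odd prime. For any positive integer $n$ satisfying $n^2 2^{4n-4} < q$ and arbitrary pairwise distinct elements $a_1, \ldots, a_n \in \mathbb{F}_q$, the directed graph $\mathcal{G}(X^2+a_1, \ldots, X^2+a_n)$ has a leaf.
   Context: $\mathbb{F}_q$ is the finite field of $q$ elements. For polynomials $f_1,\ldots,f_n \in \mathbb{F}_q[X]$, $\mathcal{G}(f_1,\ldots,f_n)$ is the directed graph with nodes labelled by the elements of $\mathbb{F}_q$ and with an edge from $u$ to $v$ ($u,v\in\mathbb{F}_q$) if and only if $f_i(u)=v$ for some $i=1,\ldots,n$. A leaf is a vertex of in-degree $0$. *)

theory Defs
  imports
    "HOL-Analysis.Analysis"
    "HOL-Computational_Algebra.Computational_Algebra"
    "Graph_Theory.Digraph"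
    "Graph_Theory.Pair_Digraph"
begin

text \<open>
  Arcs are pairs of vertices, so loops are allowed, but \<open>f i u = f j u\<close> for \<open>i \<noteq> j\<close>
  gives only one arc.
\<close>

definition poly_digraph :: "nat \<Rightarrow> (nat \<Rightarrow> 'a::{field,finite} poly) \<Rightarrow> 'a pair_pre_digraph" where
  "poly_digraph n f =
     \<lparr> pverts = UNIV, parcs = {(u, v). \<exists>i\<in>{1..n}. poly (f i) u = v} \<rparr>"

text \<open>
  The in-degree is a \<^const>\<open>card\<close>, hence meaningful only if the set of incoming arcs is
  finite; this always holds for \<^const>\<open>poly_digraph\<close>.
\<close>

definition is_leaf :: "('v, 'e) pre_digraph \<Rightarrow> 'v \<Rightarrow> bool" where
  "is_leaf G v \<longleftrightarrow> v \<in> verts G \<and> in_degree G v = 0"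

end

theory Submission
  imports Defs
begin

text \<open>
  A vertex \<open>v\<close> is a leaf as soon as every \<open>v - a\<^sub>i\<close> is a non-square. With the quadratic
  character \<open>\<chi>\<close>, the sum of \<open>\<Prod>\<^sub>i (1 - \<chi> (v - a\<^sub>i))\<close> over all \<open>v\<close> counts such vertices with weight
  \<open>2\<^sup>n\<close>, up to a contribution of at most \<open>n 2\<^sup>n\<close> from the \<open>v\<close> that equal some \<open>a\<^sub>i\<close>. Expanding the
  product gives a main term \<open>q\<close>, terms \<open>\<Sum>\<^sub>v \<chi> (v - a\<^sub>i) = 0\<close>, and one character sum for each
  subset of at least two of the \<open>a\<^sub>i\<close>. When each of those sums is at most
  \<open>(3n - 1) q / (n 4\<^bsup>n-1\<^esup>) + n\<close>, they cannot cancel the main term, and so some \<open>v\<close> has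
  \<open>\<chi> (v - a\<^sub>i) = -1\<close> for all \<open>i\<close>. For \<open>q\<close> close to its lower limit \<open>n\<^sup>2 16\<^bsup>n-1\<^esup>\<close> this is an estimate
  of order \<open>n \<surd>q\<close>, as in Weil's theorem.

  The hypothesis on \<open>q\<close> is generous enough that Weil's bound with its sharp constant can be
  replaced by an elementary estimate (\<open>character_sum_bound\<close>) obtained from Stepanov's method.
  Let \<open>f = \<Prod>\<^bsub>a\<in>S\<^esub> (X - a)\<close> have degree \<open>m\<close> and put \<open>c = (q - 1) / 2\<close>. To bound the number of \<open>x\<close>
  with \<open>f(x)\<^sup>c = \<epsilon>\<close>, one looks for a nonzero polynomial
  \<open>R = h\<^sub>0(X, X\<^sup>q) + f\<^sup>c h\<^sub>1(X, X\<^sup>q)\<close> of small degree that vanishes at all these \<open>x\<close> to a high order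
  \<open>M\<close>; then \<open>M\<close> times their number is at most \<open>degree R\<close>.

  Near such an \<open>x\<close>, and modulo \<open>(X - x)\<^sup>M\<close> with \<open>M \<le> q\<close>, the polynomial \<open>X\<^sup>q\<close> is the constant \<open>x\<close>,
  because \<open>X\<^sup>q - x = (X - x)\<^sup>q\<close>. The factor \<open>f\<^sup>c\<close> is handled by expanding in \<open>Z = (X - x) / f(x)\<close>:
  one has \<open>f(X + f(X) Z) = f(X) U(X, Z)\<close> with a polynomial \<open>U\<close>, so \<open>f\<^sup>c\<close> becomes \<open>\<epsilon> U\<^sup>c\<close>, and the
  coefficients of \<open>U\<^sup>c\<close> at \<open>Z\<^sup>l\<close> have degree at most \<open>(m - 1) l\<close> in \<open>X\<close>, regardless of the large
  exponent \<open>c\<close>. This weighted degree bound is what hyperderivatives provide in the usual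
  presentation. Vanishing to order \<open>M\<close> is therefore implied by a few linear conditions on the
  coefficients of \<open>h\<^sub>0\<close> and \<open>h\<^sub>1\<close>; having more coefficients than conditions, a nontrivial solution
  exists by the pigeonhole principle (\<open>ex_vanishing_pair\<close>). Finally \<open>R \<noteq> 0\<close> because \<open>f\<close> is
  squarefree (\<open>auxiliary_poly_nonzero\<close>). Applied to both signs \<open>\<epsilon>\<close>, the upper bound also
  yields the lower one.
\<close>

section \<open>The polynomial \<open>X\<^sup>q\<close> over a field with \<open>q\<close> elements\<close>

lemma power_card_field:
  fixes x :: "'a::{field,finite}"
  shows "x ^ CARD('a) = x"
proof (cases "x = 0")
  case False
  have "(\<Prod>y\<in>UNIV-{0}. x * y) = (\<Prod>y\<in>UNIV-{0}. y)"
    by (rule prod.reindex_bij_witness[of _ "\<lambda>y. y / x" "\<lambda>y. x * y"]) (use False in auto)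
  moreover have "(\<Prod>y\<in>UNIV-{0::'a}. x * y) = x ^ (CARD('a) - 1) * (\<Prod>y\<in>UNIV-{0}. y)"
    by (simp add: prod.distrib card_Diff_singleton)
  ultimately have "x ^ (CARD('a) - 1) = 1"
    by simp
  moreover have "CARD('a) = Suc (CARD('a) - 1)"
    by simp
  ultimately show ?thesis
    by (metis mult.right_neutral power_Suc)
qed auto

text \<open>
  Both sides are monic of degree \<open>q\<close> and agree at all \<open>q\<close> elements of the field.
\<close>

lemma monom_card_minus_const:
  fixes x :: "'a::{field,finite}"
  shows "monom 1 CARD('a) - [:x:] = [:-x, 1:] ^ CARD('a)"
proof (rule ccontr)
  let ?q = "CARD('a)"
  have q: "?q > 1"
    using card_mono[of UNIV "{0, 1::'a}"] by simp
  define D where "D = monom 1 ?q - [:x:] - [:-x, 1:] ^ ?q"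
  assume "\<not> ?thesis"
  hence "D \<noteq> 0"
    by (simp add: D_def)
  have "poly D y = 0" for y
    by (simp add: D_def poly_monom power_card_field)
  hence "{y. poly D y = 0} = UNIV"
    by blast
  hence "?q \<le> degree D"
    using card_poly_roots_bound[OF \<open>D \<noteq> 0\<close>] by simp
  moreover have "degree D < ?q"
  proof -
    have lead: "coeff ([:-x, 1:] ^ ?q) ?q = 1"
      by (metis coeff_linear_power)
    have "degree D \<le> ?q"
      unfolding D_def by (intro degree_diff_le) (auto simp: degree_monom_eq degree_linear_power)
    moreover have "coeff D ?q = 0"
      using lead q by (simp add: D_def coeff_pCons split: nat.split)
    ultimately show ?thesis
      using \<open>D \<noteq> 0\<close> by (metis le_neq_implies_less leading_coeff_0_iff)
  qed
  ultimately show False by simp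
qed

section \<open>Weighted degrees of bivariate polynomials\<close>

lemma map_poly_ring_hom_add:
  assumes "f 0 = 0" "\<And>a b. f (a + b) = f a + f b"
  shows "map_poly f (p + q) = map_poly f p + map_poly f q"
  by (rule poly_eqI) (simp add: coeff_map_poly assms)

lemma map_poly_ring_hom_mult:
  fixes f :: "'a::comm_semiring_0 \<Rightarrow> 'b::comm_semiring_0"
  assumes "f 0 = 0" "\<And>a b. f (a + b) = f a + f b" "\<And>a b. f (a * b) = f a * f b"
  shows "map_poly f (p * q) = map_poly f p * map_poly f q"
proof (rule poly_eqI)
  fix n
  have sum: "f (sum g A) = (\<Sum>x\<in>A. f (g x))" if "finite A" for g and A :: "nat set"
    using that by (induction A rule: finite_induct) (simp_all add: assms)
  show "coeff (map_poly f (p * q)) n = coeff (map_poly f p * map_poly f q) n"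
    by (simp add: coeff_map_poly assms coeff_mult sum)
qed

text \<open>
  An element of \<^typ>\<open>'a poly poly\<close> is read as a polynomial in \<open>X\<close> (inner variable) and \<open>Z\<close>
  (outer variable). If \<open>X\<close> has weight \<open>1\<close> and \<open>Z\<close> has weight \<open>-w\<close>, the total weight is at most \<open>d\<close>.
  Such bounds add up under products; for \<open>d = 0\<close> the bound is inherited by arbitrary powers.
\<close>

definition weighted_degree_le :: "nat \<Rightarrow> nat \<Rightarrow> 'a::comm_ring_1 poly poly \<Rightarrow> bool" where
  "weighted_degree_le w d P \<longleftrightarrow> (\<forall>l. degree (coeff P l) \<le> d + w * l)"

lemma weighted_degree_le_0 [simp]: "weighted_degree_le w d 0"
  by (simp add: weighted_degree_le_def)

lemma weighted_degree_le_add: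
  "weighted_degree_le w d P \<Longrightarrow> weighted_degree_le w d Q \<Longrightarrow> weighted_degree_le w d (P + Q)"
  by (auto simp: weighted_degree_le_def intro: degree_add_le)

lemma weighted_degree_le_const:
  "degree c \<le> d \<Longrightarrow> weighted_degree_le w d [:c:]"
  by (auto simp: weighted_degree_le_def coeff_pCons split: nat.split)

lemma weighted_degree_le_mono:
  "weighted_degree_le w d P \<Longrightarrow> d \<le> e \<Longrightarrow> weighted_degree_le w e P"
  unfolding weighted_degree_le_def by (meson add_le_mono1 order_trans)

lemma weighted_degree_le_mult:
  assumes "weighted_degree_le w d P" "weighted_degree_le w e Q"
  shows "weighted_degree_le w (d + e) (P * Q)"
  unfolding weighted_degree_le_def
proof
  fix l
  show "degree (coeff (P * Q) l) \<le> d + e + w * l"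
    unfolding coeff_mult
  proof (intro degree_sum_le)
    fix i assume "i \<in> {..l}"
    hence l: "l = i + (l - i)" by simp
    have "degree (coeff P i * coeff Q (l - i)) \<le> degree (coeff P i) + degree (coeff Q (l - i))"
      by (rule degree_mult_le)
    also have "\<dots> \<le> (d + w * i) + (e + w * (l - i))"
      using assms unfolding weighted_degree_le_def by (intro add_mono) auto
    also have "\<dots> = d + e + w * l"
      using l by (metis add.assoc add.left_commute add_mult_distrib2)
    finally show "degree (coeff P i * coeff Q (l - i)) \<le> d + e + w * l" .
  qed auto
qed

lemma weighted_degree_le_power:
  "weighted_degree_le w 0 P \<Longrightarrow> weighted_degree_le w 0 (P ^ k)"
proof (induction k)
  case 0
  show ?case using weighted_degree_le_const[of 1 0 w] by (simp add: one_pCons)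
next
  case (Suc k)
  thus ?case using weighted_degree_le_mult[of w 0 P 0 "P ^ k"] by simp
qed

section \<open>Taylor expansion with step \<open>f(X) Z\<close>\<close>

text \<open>
  The polynomial \<open>h(X + f(X) Z)\<close>. The factor \<open>f(X)\<close> in the step clears the denominators that
  the expansion of a power of \<open>f\<close> would otherwise have.
\<close>

definition shift_along :: "'a::field poly \<Rightarrow> 'a poly \<Rightarrow> 'a poly poly" where
  "shift_along f h = poly (map_poly (\<lambda>c. [:[:c:]:]) h) [:[:0, 1:], f:]"

lemma shift_along_0 [simp]: "shift_along f 0 = 0"
  by (simp add: shift_along_def)

lemma shift_along_pCons:
  "shift_along f (pCons a h) = [:[:a:]:] + [:[:0, 1:], f:] * shift_along f h"
  by (simp add: shift_along_def map_poly_pCons)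

lemma shift_along_add: "shift_along f (g + h) = shift_along f g + shift_along f h"
  by (simp add: shift_along_def map_poly_ring_hom_add)

lemma weighted_degree_le_shift_along:
  assumes "degree f \<ge> 1"
  shows "weighted_degree_le (degree f - 1) (degree h) (shift_along f h)"
proof (induction h)
  case (pCons a h)
  have 1: "weighted_degree_le (degree f - 1) 1 [:[:0, 1:], f:]"
    using assms by (auto simp: weighted_degree_le_def coeff_pCons split: nat.split)
  have "weighted_degree_le (degree f - 1) (degree (pCons a h)) ([:[:0, 1:], f:] * shift_along f h)"
  proof (cases "h = 0")
    case False
    thus ?thesis using weighted_degree_le_mult[OF 1 pCons.IH] by simp
  qed auto
  thus ?case
    unfolding shift_along_pCons
    by (intro weighted_degree_le_add weighted_degree_le_const) auto
qed auto

lemma shift_along_cong_const: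
  "\<exists>Q. shift_along f h = [:h:] + [:0, f:] * Q"
proof (induction h)
  case (pCons a h)
  then obtain Q where Q: "shift_along f h = [:h:] + [:0, f:] * Q" by blast
  have X: "[:[:0, 1:], f:] = [:[:0, 1:]:] + [:0, f:]" by simp
  have "shift_along f (pCons a h) = [:[:a:]:] + [:[:0,1:]:] * [:h:] + [:0, f:] * ([:h:] + [:[:0,1:]:] * Q + [:0, f:] * Q)"
    unfolding shift_along_pCons Q X by (simp only: algebra_simps)
  also have "[:[:a:]:] + [:[:0,1:]:] * [:h:] = [:pCons a h:]"
    by simp
  finally show ?case by blast
qed (auto intro: exI[of _ 0])

text \<open>
  The quotient \<open>U\<close> exists because \<open>f(X + f(X) Z)\<close> is congruent to \<open>f(X)\<close> modulo \<open>f(X) Z\<close>; dividing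
  by \<open>f\<close> lowers the weighted degree to \<open>0\<close>, so that the bound holds for every power of \<open>U\<close>.
\<close>

lemma shift_along_self:
  assumes "degree f \<ge> 1"
  obtains U where "shift_along f f = [:f:] * U" "weighted_degree_le (degree f - 1) 0 U"
proof -
  obtain Q where Q: "shift_along f f = [:f:] + [:0, f:] * Q"
    using shift_along_cong_const by blast
  define U where "U = 1 + [:0, 1:] * Q"
  have "[:0, f:] = [:f:] * [:0, 1:]" by simp
  hence eq: "shift_along f f = [:f:] * U"
    unfolding Q U_def by (simp only: algebra_simps)  simp
  have "degree (coeff U l) \<le> (degree f - 1) * l" for l
  proof (cases "coeff U l = 0")
    case False
    have "degree (f * coeff U l) \<le> degree f + (degree f - 1) * l"
      using weighted_degree_le_shift_along[OF assms, of f] unfolding eq weighted_degree_le_def by simp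
    moreover have "f \<noteq> 0" using assms by auto
    ultimately show ?thesis using False by (simp add: degree_mult_eq)
  qed auto
  thus ?thesis using eq that by (auto simp: weighted_degree_le_def)
qed

text \<open>
  For \<open>h(X, Y)\<close> with outer variable \<open>Y\<close>: shift \<open>X\<close> and set \<open>Y = X\<close>. The unshifted \<open>X\<close> stands for the
  base point \<open>x\<close>, which is what \<open>Y = X\<^sup>q\<close> is congruent to near \<open>x\<close>.
\<close>

definition shift_along_diagonal :: "'a::field poly \<Rightarrow> 'a poly poly \<Rightarrow> 'a poly poly" where
  "shift_along_diagonal f h = poly (map_poly (shift_along f) h) [:[:0, 1:]:]"

lemma shift_along_diagonal_0 [simp]: "shift_along_diagonal f 0 = 0"
  by (simp add: shift_along_diagonal_def)

lemma shift_along_diagonal_pCons: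
  "shift_along_diagonal f (pCons c h) = shift_along f c + [:[:0, 1:]:] * shift_along_diagonal f h"
  by (simp add: shift_along_diagonal_def map_poly_pCons)

lemma shift_along_diagonal_add: "shift_along_diagonal f (g + h) = shift_along_diagonal f g + shift_along_diagonal f h"
  by (simp add: shift_along_diagonal_def map_poly_ring_hom_add shift_along_add)

lemma weighted_degree_le_shift_along_diagonal:
  assumes "degree f \<ge> 1" "\<And>j. degree (coeff h j) \<le> A"
  shows "weighted_degree_le (degree f - 1) (A + degree h) (shift_along_diagonal f h)"
  using assms(2)
proof (induction h)
  case (pCons c h)
  have A: "degree c \<le> A" "\<And>j. degree (coeff h j) \<le> A"
    using pCons.prems[of 0] pCons.prems[of "Suc _"] by auto
  have 1: "weighted_degree_le (degree f - 1) 1 [:[:0, 1:]:]"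
    by (rule weighted_degree_le_const) auto
  have "weighted_degree_le (degree f - 1) (A + degree (pCons c h)) ([:[:0, 1:]:] * shift_along_diagonal f h)"
  proof (cases "h = 0")
    case False
    thus ?thesis using weighted_degree_le_mult[OF 1 pCons.IH[OF A(2)]] by simp
  qed auto
  moreover have "weighted_degree_le (degree f - 1) (A + degree (pCons c h)) (shift_along f c)"
    by (rule weighted_degree_le_mono[OF weighted_degree_le_shift_along]) (use assms A in auto)
  ultimately show ?case
    unfolding shift_along_diagonal_pCons by (intro weighted_degree_le_add)
qed auto

text \<open>
  The ring homomorphism that substitutes \<open>X := x\<close> and \<open>Z := (X - x) / f(x)\<close>. It undoes the shift:
  the point \<open>x + f(x) Z\<close> becomes \<open>X\<close> again.
\<close>

definition local_eval :: "'a::field poly \<Rightarrow> 'a \<Rightarrow> 'a poly poly \<Rightarrow> 'a poly" where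
  "local_eval f x P = poly (map_poly (\<lambda>c. [:poly c x:]) P) (smult (1 / poly f x) [:-x, 1:])"

lemma local_eval_0 [simp]: "local_eval f x 0 = 0"
  by (simp add: local_eval_def)

lemma local_eval_add: "local_eval f x (P + Q) = local_eval f x P + local_eval f x Q"
  by (simp add: local_eval_def map_poly_ring_hom_add)

lemma local_eval_mult: "local_eval f x (P * Q) = local_eval f x P * local_eval f x Q"
  unfolding local_eval_def
  by (subst map_poly_ring_hom_mult) simp_all

lemma local_eval_const: "local_eval f x [:c:] = [:poly c x:]"
  by (simp add: local_eval_def map_poly_pCons)

lemma local_eval_power: "local_eval f x (P ^ k) = local_eval f x P ^ k"
proof (induction k)
  case 0
  show ?case using local_eval_const[of f x 1] by (simp add: one_pCons)
qed (simp add: local_eval_mult)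

lemma local_eval_shift_along:
  assumes "poly f x \<noteq> 0"
  shows "local_eval f x (shift_along f h) = h"
proof (induction h)
  case (pCons a h)
  have "local_eval f x [:[:0, 1:], f:] = [:0, 1:]"
    using assms by (simp add: local_eval_def map_poly_pCons)
  thus ?case
    unfolding shift_along_pCons local_eval_add local_eval_mult local_eval_const pCons.IH by simp
qed auto

lemma local_eval_shift_along_diagonal:
  assumes "poly f x \<noteq> 0"
  shows "local_eval f x (shift_along_diagonal f h) = poly h [:x:]"
proof (induction h)
  case (pCons c h)
  show ?case
    unfolding shift_along_diagonal_pCons local_eval_add local_eval_mult local_eval_const pCons.IH
      local_eval_shift_along[OF assms] by simp
qed auto

lemma power_dvd_local_eval:
  assumes "\<And>l. l < M \<Longrightarrow> coeff P l = 0"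
  shows "[:-x, 1:] ^ M dvd local_eval f x P"
proof -
  have "monom 1 M dvd P"
    using assms by (simp add: monom_1_dvd_iff')
  then obtain Q where P: "P = monom 1 M * Q" by blast
  have "local_eval f x P = (smult (1 / poly f x) [:-x, 1:]) ^ M * local_eval f x Q"
    unfolding P local_eval_mult by (simp add: local_eval_def map_poly_monom poly_monom)
  also have "\<dots> = smult ((1 / poly f x) ^ M) ([:-x, 1:] ^ M * local_eval f x Q)"
    by (simp only: smult_power mult_smult_left)
  also have "[:-x, 1:] ^ M dvd \<dots>"
    by (intro dvd_smult dvd_triv_left)
  finally show ?thesis .
qed

section \<open>Existence of the auxiliary polynomial\<close>

text \<open>
  Used twice: with all field elements as coefficients for bounded univariate polynomials, and with
  those univariate polynomials as coefficients for bivariate ones.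
\<close>

definition polys_over :: "'b::zero set \<Rightarrow> nat \<Rightarrow> 'b poly set" where
  "polys_over C n = {p. degree p \<le> n \<and> (\<forall>i. coeff p i \<in> C)}"

lemma card_polys_over:
  assumes "finite C" "0 \<in> C"
  shows "finite (polys_over C n) \<and> card (polys_over C n) = card C ^ Suc n"
proof (induction n)
  case 0
  have "polys_over C 0 = (\<lambda>c. [:c:]) ` C"
  proof
    show "polys_over C 0 \<subseteq> (\<lambda>c. [:c:]) ` C"
      by (auto simp: polys_over_def elim!: degree_eq_zeroE split: if_splits)
         (metis coeff_pCons_0 imageI)
    show "(\<lambda>c. [:c:]) ` C \<subseteq> polys_over C 0"
      using assms by (auto simp: polys_over_def coeff_pCons split: nat.split)
  qed
  moreover have "inj_on (\<lambda>c. [:c:]) C"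
    by (auto simp: inj_on_def)
  ultimately show ?case
    using assms by (simp add: card_image)
next
  case (Suc n)
  let ?f = "\<lambda>(c, p). pCons c p"
  have "polys_over C (Suc n) = ?f ` (C \<times> polys_over C n)"
  proof
    show "polys_over C (Suc n) \<subseteq> ?f ` (C \<times> polys_over C n)"
    proof
      fix p assume p: "p \<in> polys_over C (Suc n)"
      obtain c r where cr: "p = pCons c r" by (cases p)
      have "coeff p 0 \<in> C" "\<And>i. coeff p (Suc i) \<in> C"
        using p unfolding polys_over_def by blast+
      moreover have "degree r \<le> n"
        using p cr by (auto simp: polys_over_def split: if_splits)
      ultimately show "p \<in> ?f ` (C \<times> polys_over C n)"
        using cr by (auto simp: polys_over_def)
    qed
    show "?f ` (C \<times> polys_over C n) \<subseteq> polys_over C (Suc n)"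
      by (auto simp: polys_over_def coeff_pCons split: nat.split)
  qed
  moreover have "inj_on ?f (C \<times> polys_over C n)"
    by (auto simp: inj_on_def)
  ultimately show ?case
    using assms Suc.IH by (simp add: card_image card_cartesian_product)
qed

lemma card_degree_le:
  "finite {p :: 'a::{field,finite} poly. degree p \<le> n}"
  "card {p :: 'a::{field,finite} poly. degree p \<le> n} = CARD('a) ^ Suc n"
  using card_polys_over[of "UNIV :: 'a set" n] by (simp_all add: polys_over_def)

text \<open>
  Siegel's lemma over a finite field: the source has more elements than the target, so two of
  them share their image. Counting elements replaces a dimension argument.
\<close>

lemma additive_kernel_nontrivial:
  fixes \<Phi> :: "'b::ab_group_add \<Rightarrow> 'i \<Rightarrow> 'c::ab_group_add"
  assumes "finite I" "finite W" "card W ^ card I < card V"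
    and "\<And>v i. v \<in> V \<Longrightarrow> i \<in> I \<Longrightarrow> \<Phi> v i \<in> W"
    and "\<And>u v i. \<Phi> (u - v) i = \<Phi> u i - \<Phi> v i"
  shows "\<exists>u\<in>V. \<exists>v\<in>V. u \<noteq> v \<and> (\<forall>i\<in>I. \<Phi> (u - v) i = 0)"
proof -
  let ?g = "\<lambda>v. restrict (\<Phi> v) I"
  have "?g ` V \<subseteq> I \<rightarrow>\<^sub>E W"
    using assms(4) by auto
  hence "card (?g ` V) \<le> card (I \<rightarrow>\<^sub>E W)"
    using assms by (intro card_mono finite_PiE) auto
  also have "\<dots> < card V"
    using assms by (simp add: card_PiE)
  finally have "\<not> inj_on ?g V"
    by (rule pigeonhole)
  then obtain u v where uv: "u \<in> V" "v \<in> V" "u \<noteq> v" "?g u = ?g v"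
    by (auto simp: inj_on_def)
  have "\<Phi> u i = \<Phi> v i" if "i \<in> I" for i
    using fun_cong[OF uv(4), of i] that by simp
  thus ?thesis
    using uv assms(5) by force
qed

lemma diff_dvd_poly_diff:
  fixes x y :: "'a::comm_ring_1"
  shows "x - y dvd poly h x - poly h y"
proof (induction h)
  case (pCons a h)
  have "poly (pCons a h) x - poly (pCons a h) y = (x - y) * poly h x + y * (poly h x - poly h y)"
    by (simp add: algebra_simps)
  moreover have "x - y dvd (x - y) * poly h x + y * (poly h x - poly h y)"
    using pCons.IH by (intro dvd_add dvd_mult dvd_triv_left)
  ultimately show ?case
    by (simp only:)
qed auto

text \<open>
  The right-hand side of \<open>count\<close> is the number of coefficients of the pair \<open>(h\<^sub>0, h\<^sub>1)\<close>; the left-hand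
  side bounds the number of linear conditions saying that the coefficients of \<open>Z\<^sup>l\<close> for \<open>l < M\<close> in
  \<open>h\<^sub>0(X + f(X) Z, X) + \<epsilon> U(X, Z)\<^sup>c h\<^sub>1(X + f(X) Z, X)\<close> vanish identically in \<open>X\<close>. These conditions do not
  mention \<open>x\<close>, so a single solution serves all points with \<open>f(x)\<^sup>c = \<epsilon>\<close>.
\<close>

lemma ex_vanishing_pair:
  fixes f :: "'a::{field,finite} poly" and \<epsilon> :: 'a
  assumes f: "degree f \<ge> 1" and M: "M \<le> CARD('a)"
    and count: "M * (A + J + (degree f - 1) * (M - 1) + 1) < 2 * ((A + 1) * (J + 1))"
  obtains h0 h1 :: "'a poly poly"
  where "h0 \<noteq> 0 \<or> h1 \<noteq> 0" "degree h0 \<le> J" "degree h1 \<le> J"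
    "\<And>j. degree (coeff h0 j) \<le> A" "\<And>j. degree (coeff h1 j) \<le> A"
    "\<And>x. poly f x \<noteq> 0 \<Longrightarrow> poly f x ^ c = \<epsilon> \<Longrightarrow>
       [:-x, 1:] ^ M dvd poly h0 (monom 1 CARD('a)) + f ^ c * poly h1 (monom 1 CARD('a))"
proof -
  let ?q = "CARD('a)" and ?w = "degree f - 1"
  obtain U where U: "shift_along f f = [:f:] * U" "weighted_degree_le ?w 0 U"
    using shift_along_self[OF f] by blast
  define \<Phi> :: "'a poly poly \<times> 'a poly poly \<Rightarrow> 'a poly poly" where
    "\<Phi> h = shift_along_diagonal f (fst h) + [:[:\<epsilon>:]:] * U ^ c * shift_along_diagonal f (snd h)" for h
  have \<Phi>_diff: "\<Phi> (g - h) = \<Phi> g - \<Phi> h" for g h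
  proof -
    have "shift_along_diagonal f (r - s) = shift_along_diagonal f r - shift_along_diagonal f s" for r s
      using shift_along_diagonal_add[of f "r - s" s] by (simp add: algebra_simps)
    thus ?thesis by (simp only: \<Phi>_def fst_diff snd_diff ring_distribs) simp
  qed
  define P where "P = polys_over {p :: 'a poly. degree p \<le> A} J"
  define W where "W = {p :: 'a poly. degree p \<le> A + J + ?w * (M - 1)}"
  have card_P: "finite P \<and> card P = ?q ^ ((A + 1) * (J + 1))"
    using card_polys_over[OF card_degree_le(1), of A J]
    by (simp add: P_def card_degree_le flip: power_mult power_add power_Suc)
  have card_W: "finite W" "card W = ?q ^ (A + J + ?w * (M - 1) + 1)"
    by (simp_all add: W_def card_degree_le)
  have q: "?q > 1"
    using card_mono[of UNIV "{0, 1::'a}"] by simp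
  have "\<exists>g\<in>P \<times> P. \<exists>h\<in>P \<times> P. g \<noteq> h \<and> (\<forall>l\<in>{..<M}. coeff (\<Phi> (g - h)) l = 0)"
  proof (rule additive_kernel_nontrivial[where W = W])
    show "card W ^ card {..<M} < card (P \<times> P)"
      using count q
      by (simp add: card_cartesian_product card_P card_W(2) power_strict_increasing_iff mult.commute
               flip: power_mult power_add del: power_Suc One_nat_def)
    fix v l assume v: "v \<in> P \<times> P" and l: "l \<in> {..<M}"
    have shift: "weighted_degree_le ?w (A + J) (shift_along_diagonal f h)" if "h \<in> P" for h
      using that by (intro weighted_degree_le_mono[OF weighted_degree_le_shift_along_diagonal[of f h A]] f)
                    (auto simp: P_def polys_over_def)
    have "weighted_degree_le ?w (A + J) (\<Phi> v)"
      unfolding \<Phi>_def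
    proof (rule weighted_degree_le_add)
      have "weighted_degree_le ?w (0 + 0 + (A + J)) ([:[:\<epsilon>:]:] * U ^ c * shift_along_diagonal f (snd v))"
        using v by (intro weighted_degree_le_mult weighted_degree_le_power weighted_degree_le_const U shift) auto
      thus "weighted_degree_le ?w (A + J) ([:[:\<epsilon>:]:] * U ^ c * shift_along_diagonal f (snd v))"
        by (simp only: add_0)
      show "weighted_degree_le ?w (A + J) (shift_along_diagonal f (fst v))"
        using v by (intro shift) auto
    qed
    hence "degree (coeff (\<Phi> v) l) \<le> A + J + ?w * l"
      by (auto simp: weighted_degree_le_def)
    also have "\<dots> \<le> A + J + ?w * (M - 1)"
      using l by (intro add_left_mono mult_left_mono) auto
    finally show "coeff (\<Phi> v) l \<in> W"
      by (simp add: W_def)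
  qed (auto simp: card_W \<Phi>_diff)
  then obtain g h where gh: "g \<in> P \<times> P" "h \<in> P \<times> P" "g \<noteq> h"
    and zero: "\<And>l. l < M \<Longrightarrow> coeff (\<Phi> (g - h)) l = 0"
    by auto
  define h0 h1 where "h0 = fst (g - h)" and "h1 = snd (g - h)"
  show ?thesis
  proof (rule that[of h0 h1])
    show "h0 \<noteq> 0 \<or> h1 \<noteq> 0"
      using gh(3) by (auto simp: h0_def h1_def prod_eq_iff)
    have diff: "degree (r - s) \<le> J \<and> (\<forall>j. degree (coeff (r - s) j) \<le> A)" if "r \<in> P" "s \<in> P" for r s
      using that by (auto simp: P_def polys_over_def intro!: degree_diff_le)
    show "degree h0 \<le> J" "degree h1 \<le> J" "degree (coeff h0 j) \<le> A" "degree (coeff h1 j) \<le> A" for j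
      using gh diff[of "fst g" "fst h"] diff[of "snd g" "snd h"]
      by (auto simp: h0_def h1_def mem_Times_iff)
    fix x assume x: "poly f x \<noteq> 0" "poly f x ^ c = \<epsilon>"
    \<comment> \<open>\<open>X\<^sup>q\<close> may be replaced by the constant \<open>x\<close>, since \<open>X\<^sup>q - x = (X - x)\<^sup>q\<close> and \<open>M \<le> q\<close>.\<close>
    have cong: "[:-x, 1:] ^ M dvd poly h (monom 1 ?q) - poly h [:x:]" for h :: "'a poly poly"
    proof -
      have "[:-x, 1:] ^ M dvd [:-x, 1:] ^ ?q"
        using M by (rule le_imp_power_dvd)
      also have "\<dots> = monom 1 ?q - [:x:]"
        by (rule monom_card_minus_const [symmetric])
      also have "\<dots> dvd poly h (monom 1 ?q) - poly h [:x:]"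
        by (rule diff_dvd_poly_diff)
      finally show ?thesis .
    qed
    \<comment> \<open>In the coordinate \<open>Z\<close>, the power \<open>f\<^sup>c\<close> is \<open>f(x)\<^sup>c U\<^sup>c = \<epsilon> U\<^sup>c\<close>.\<close>
    have "f = local_eval f x (shift_along f f)"
      by (simp only: local_eval_shift_along[OF x(1)])
    also have "\<dots> = [:poly f x:] * local_eval f x U"
      by (simp only: U local_eval_mult local_eval_const)
    finally have "f ^ c = [:\<epsilon>:] * local_eval f x U ^ c"
      by (metis power_mult_distrib poly_const_pow x(2))
    hence "local_eval f x (\<Phi> (g - h)) = poly h0 [:x:] + f ^ c * poly h1 [:x:]"
      by (simp add: \<Phi>_def h0_def h1_def local_eval_add local_eval_mult local_eval_const
            local_eval_power local_eval_shift_along_diagonal[OF x(1)] del: fst_diff snd_diff mult_pCons_left)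
    hence "[:-x, 1:] ^ M dvd poly h0 [:x:] + f ^ c * poly h1 [:x:]"
      using power_dvd_local_eval[of M "\<Phi> (g - h)" x f, OF zero] by simp
    hence "[:-x, 1:] ^ M dvd (poly h0 [:x:] + f ^ c * poly h1 [:x:])
        + (poly h0 (monom 1 ?q) - poly h0 [:x:]) + f ^ c * (poly h1 (monom 1 ?q) - poly h1 [:x:])"
      by (rule dvd_add[OF dvd_add[OF _ cong[of h0]] dvd_mult[OF cong[of h1]]])
    moreover have "a + g * b + (P - a) + g * (Q - b) = P + g * Q" for a b g P Q :: "'a poly"
      by (simp add: algebra_simps)
    ultimately show "[:-x, 1:] ^ M dvd poly h0 (monom 1 ?q) + f ^ c * poly h1 (monom 1 ?q)"
      by (simp only:)
  qed
qed

section \<open>Non-vanishing of the auxiliary polynomial\<close>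

text \<open>
  Uniqueness of digits in base \<open>X\<^sup>n\<close>.
\<close>

lemma poly_at_monom_eq_0:
  fixes h :: "'a::field poly poly"
  assumes "\<And>j. degree (coeff h j) < n" "poly h (monom 1 n) = 0"
  shows "h = 0"
  using assms
proof (induction h)
  case (pCons c h)
  have c: "degree c < n" and h: "\<And>j. degree (coeff h j) < n"
    using pCons.prems(1)[of 0] pCons.prems(1)[of "Suc _"] by auto
  have eq: "c = - (monom 1 n * poly h (monom 1 n))"
    using pCons.prems(2) by (simp add: eq_neg_iff_add_eq_0)
  have "poly h (monom 1 n) = 0"
  proof (rule ccontr)
    assume "poly h (monom 1 n) \<noteq> 0"
    hence "degree c = n + degree (poly h (monom 1 n))"
      unfolding eq by (simp add: degree_mult_eq degree_monom_eq monom_eq_0_iff)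
    thus False using c by simp
  qed
  thus ?case using eq pCons.IH[OF h] by simp
qed auto

text \<open>
  Compare leading coefficients in the outer variable: \<open>f a\<^sup>2 = c b\<^sup>2\<close> with univariate \<open>a\<close>, \<open>b\<close> and a
  nonzero constant \<open>c\<close>. The root \<open>r\<close> has odd order on the left and even order on the right.
\<close>

lemma no_square_relation:
  fixes f :: "'a::field poly" and F h0 h1 :: "'a poly poly"
  assumes odd: "odd (order r f)" "f \<noteq> 0" and F: "F \<noteq> 0" "lead_coeff F = [:c:]"
    and eq: "smult f (h0\<^sup>2) = F * h1\<^sup>2"
  shows "h0 = 0 \<and> h1 = 0"
proof (rule ccontr)
  assume "\<not> ?thesis"
  hence nz: "h0 \<noteq> 0" "h1 \<noteq> 0"
    using assms(2-) by (auto simp: power2_eq_square)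
  have "f * lead_coeff h0 * lead_coeff h0 = [:c:] * lead_coeff h1 * lead_coeff h1"
    using arg_cong[OF eq, of lead_coeff] F(2)
    by (simp only: lead_coeff_mult lead_coeff_smult power2_eq_square mult.assoc)
  hence "order r (f * lead_coeff h0 * lead_coeff h0) = order r ([:c:] * lead_coeff h1 * lead_coeff h1)"
    by (rule arg_cong)
  moreover have c: "[:c:] \<noteq> 0"
    using F by (metis leading_coeff_0_iff)
  moreover have "order r [:c:] = 0"
    using c by (intro order_0I) auto
  ultimately have "order r f + 2 * order r (lead_coeff h0) = 2 * order r (lead_coeff h1)"
    using nz \<open>f \<noteq> 0\<close> by (simp add: order_mult del: mult_pCons_left)
  thus False
    using odd(1) by presburger
qed

text \<open>
  If the sum vanished, squaring \<open>h\<^sub>0(X, X\<^sup>q) = - f\<^sup>c h\<^sub>1(X, X\<^sup>q)\<close> and multiplying by \<open>f\<close> would turn the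
  power of \<open>f\<close> into \<open>f\<^sup>q = F(X\<^sup>q)\<close>, where \<open>F\<close> is \<open>f\<close> in the outer variable. All digits in base \<open>X\<^sup>q\<close>
  are small by assumption, so this lifts to the bivariate identity \<open>f(X) h\<^sub>0\<^sup>2 = f(Y) h\<^sub>1\<^sup>2\<close>, which the
  squarefree \<open>f\<close> forbids.
\<close>

lemma auxiliary_poly_nonzero:
  fixes S :: "'a::{field,finite} set" and h0 h1 :: "'a poly poly"
  defines "f \<equiv> \<Prod>a\<in>S. [:-a, 1:]"
  assumes S: "S \<noteq> {}" and q: "odd CARD('a)" and A: "2 * A + card S < CARD('a)"
    and h: "h0 \<noteq> 0 \<or> h1 \<noteq> 0" "\<And>j. degree (coeff h0 j) \<le> A" "\<And>j. degree (coeff h1 j) \<le> A"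
  shows "poly h0 (monom 1 CARD('a)) + f ^ ((CARD('a) - 1) div 2) * poly h1 (monom 1 CARD('a)) \<noteq> 0"
proof
  let ?q = "CARD('a)" and ?c = "(CARD('a) - 1) div 2"
  let ?P0 = "poly h0 (monom 1 ?q)" and ?P1 = "poly h1 (monom 1 ?q)"
  assume "?P0 + f ^ ?c * ?P1 = 0"
  hence P0: "?P0 = - (f ^ ?c * ?P1)"
    by (simp add: eq_neg_iff_add_eq_0)
  define F :: "'a poly poly" where "F = (\<Prod>a\<in>S. [:[:-a:], 1:])"
  have "lead_coeff F = 1"
    by (simp add: F_def lead_coeff_prod)
  hence F: "F \<noteq> 0" "lead_coeff F = [:1:]"
    by (auto simp: one_pCons)
  have "f ^ ?q = (\<Prod>a\<in>S. monom 1 ?q - [:a:])"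
    by (simp add: f_def prod_power_distrib monom_card_minus_const)
  also have "\<dots> = poly F (monom 1 ?q)"
    unfolding F_def poly_prod
    by (intro prod.cong refl poly_eqI) (simp add: coeff_pCons split: nat.split)
  finally have fq: "f ^ ?q = poly F (monom 1 ?q)" .
  have "Suc (?c + ?c) = ?q"
    using q by presburger
  hence "f * (f ^ ?c * f ^ ?c) = f ^ ?q"
    by (metis power_Suc power_add)
  hence "f * ?P0\<^sup>2 = poly F (monom 1 ?q) * ?P1\<^sup>2"
    unfolding P0 fq [symmetric] by (simp add: power2_eq_square ac_simps)
  hence zero: "poly ([:f:] * (h0 * h0) - F * (h1 * h1)) (monom 1 ?q) = 0"
    by (simp add: power2_eq_square)
  have W: "weighted_degree_le 0 A h0" "weighted_degree_le 0 A h1"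
    using h by (auto simp: weighted_degree_le_def)
  have WF: "weighted_degree_le 0 0 F"
    unfolding F_def
  proof (induction S rule: infinite_finite_induct)
    case (insert a S)
    have "weighted_degree_le 0 (0 + 0) ([:[:-a:], 1:] * (\<Prod>a\<in>S. [:[:-a:], 1:]))"
      by (rule weighted_degree_le_mult[OF _ insert.IH])
         (auto simp: weighted_degree_le_def coeff_pCons split: nat.split)
    thus ?case using insert by simp
  qed (auto simp: one_pCons intro!: weighted_degree_le_const)
  have f: "degree f = card S" "f \<noteq> 0"
    by (simp_all add: f_def degree_prod_eq_sum_degree)
  have "degree (coeff ([:f:] * (h0 * h0) - F * (h1 * h1)) j) < ?q" for j
  proof -
    have "weighted_degree_le 0 (card S + (A + A)) ([:f:] * (h0 * h0))"
         "weighted_degree_le 0 (0 + (A + A)) (F * (h1 * h1))"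
      by (intro weighted_degree_le_mult weighted_degree_le_const W WF; simp add: f)+
    hence "degree (coeff ([:f:] * (h0 * h0) - F * (h1 * h1)) j) \<le> card S + (A + A)"
      unfolding weighted_degree_le_def coeff_diff by (intro degree_diff_le) (auto intro: order_trans)
    thus ?thesis using A by simp
  qed
  from poly_at_monom_eq_0[OF this zero] have "smult f (h0\<^sup>2) = F * h1\<^sup>2"
    by (simp add: power2_eq_square)
  moreover obtain r where r: "r \<in> S"
    using S by blast
  have "order r f = 1"
  proof -
    have "f = [:-r, 1:] * (\<Prod>a\<in>S-{r}. [:-a, 1:])"
      unfolding f_def using r by (subst prod.remove[of S r]) auto
    moreover have "order r (\<Prod>a\<in>S-{r}. [:-a, 1:]) = 0"
      by (rule order_0I) (auto simp: poly_prod)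
    moreover have "order r [:-r, 1:] = 1"
      using order_power_n_n[of r 1] by simp
    ultimately show ?thesis
      using f(2) by (metis add.right_neutral order_mult)
  qed
  ultimately show False
    using no_square_relation[of r f F 1 h0 h1] F f h(1) by simp
qed

section \<open>Stepanov's bound\<close>

lemma mult_card_le_degree:
  fixes R :: "'a::field poly"
  assumes "R \<noteq> 0" "finite T" "\<And>x. x \<in> T \<Longrightarrow> [:-x, 1:] ^ M dvd R"
  shows "M * card T \<le> degree R"
proof (cases "M = 0")
  case False
  have M: "M \<le> order x R" if "x \<in> T" for x
    using assms that order_divides by blast
  have "M * card T = (\<Sum>x\<in>T. M)" by simp
  also have "\<dots> \<le> (\<Sum>x\<in>T. count (proots R) x)"
    using M assms(1) by (intro sum_mono) simp
  also have "\<dots> \<le> (\<Sum>x\<in>set_mset (proots R). count (proots R) x)"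
    using M False assms(1) by (intro sum_mono2) (fastforce simp: order_root)+
  also have "\<dots> = size (proots R)"
    by (simp add: size_multiset_overloaded_eq)
  also have "\<dots> \<le> degree R"
    by (rule size_proots_le)
  finally show ?thesis .
qed auto

lemma degree_poly_at_monom_le:
  fixes h :: "'a::field poly poly"
  assumes "\<And>j. degree (coeff h j) \<le> A" "degree h \<le> J"
  shows "degree (poly h (monom 1 n)) \<le> A + n * J"
proof -
  have "degree (coeff h j * monom 1 n ^ j) \<le> A + n * J" if "j \<le> degree h" for j
  proof -
    have "degree (coeff h j * monom 1 n ^ j) \<le> degree (coeff h j) + n * j"
      by (rule order_trans[OF degree_mult_le]) (simp add: monom_power degree_monom_eq)
    also have "\<dots> \<le> A + n * J"
      using that assms by (intro add_mono mult_left_mono) auto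
    finally show ?thesis .
  qed
  thus ?thesis
    unfolding poly_altdef by (intro degree_sum_le) auto
qed

text \<open>
  The order of vanishing is \<open>M = 2 \<mu>\<close>. The \<open>X\<close>-degree \<open>A\<close> is about \<open>q / 2\<close>, the largest that
  non-vanishing permits. The \<open>Y\<close>-degree is \<open>\<mu> + m - 1\<close>: \<open>\<mu>\<close> terms are what vanishing to order \<open>2 \<mu>\<close>
  would cost without the weights \<open>(m - 1) l\<close>, and \<open>m\<close> further terms pay for those weights as long
  as \<open>4 \<mu>\<^sup>2 \<le> q\<close> and \<open>2 m\<^sup>2 < q\<close>.
\<close>

lemma stepanov_bound:
  fixes S :: "'a::{field,finite} set" and \<epsilon> :: 'a
  defines "f \<equiv> \<Prod>a\<in>S. [:-a, 1:]"
  assumes S: "S \<noteq> {}" and q: "odd CARD('a)" and \<mu>: "\<mu> \<ge> 1" "4 * \<mu>\<^sup>2 \<le> CARD('a)"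
    and m: "2 * (card S)\<^sup>2 < CARD('a)"
  shows "4 * \<mu> * card {x. poly f x \<noteq> 0 \<and> poly f x ^ ((CARD('a) - 1) div 2) = \<epsilon>}
           \<le> 2 * CARD('a) * \<mu> + CARD('a) * (3 * card S - 1)"
proof -
  define q m c A J where "q = CARD('a)" and "m = card S" and "c = (q - 1) div 2"
    and "A = (q - 1 - m) div 2" and "J = \<mu> + m - 1"
  define T where "T = {x. poly f x \<noteq> 0 \<and> poly f x ^ c = \<epsilon>}"
  have f: "degree f = m"
    by (simp add: f_def m_def degree_prod_eq_sum_degree)
  have m1: "m \<ge> 1"
    using S by (simp add: m_def Suc_le_eq card_gt_0_iff)
  have "m * 1 \<le> m * m"
    using m1 by (intro mult_left_mono) auto
  hence mq: "m < q" "2 * (m * m) < q"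
    using m unfolding m_def q_def power2_eq_square by linarith+
  have \<mu>q: "4 * (\<mu> * \<mu>) \<le> q"
    using \<mu> by (simp add: q_def power2_eq_square)
  have "\<mu> * 1 \<le> \<mu> * \<mu>"
    using \<mu> by (intro mult_left_mono) auto
  hence M: "2 * \<mu> \<le> q"
    using \<mu>q by linarith
  have A: "2 * A \<le> q - 1 - m" "q - m \<le> 2 * (A + 1)"
    by (auto simp: A_def)
  have diffs: "real (m - 1) = real m - 1" "real (3 * m - 1) = 3 * real m - 1"
      "real (2 * \<mu> - 1) = 2 * real \<mu> - 1" "real J = real \<mu> + real m - 1"
    using m1 \<mu>(1) by (simp_all add: J_def of_nat_diff)
  have count: "2 * \<mu> * (A + J + (m - 1) * (2 * \<mu> - 1) + 1) < 2 * ((A + 1) * (J + 1))"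
  proof -
    have "real (4 * (\<mu> * \<mu>)) \<le> real q"
      using \<mu>q by (simp only: of_nat_le_iff)
    hence "2 * (real \<mu> * \<mu>) * (2 * real m - 1) \<le> q / 2 * (2 * real m - 1)"
      using m1 by (intro mult_right_mono) auto
    also have "\<dots> < (real q - m) * m"
    proof -
      have "real (2 * (m * m)) < real q"
        using mq(2) by (simp only: of_nat_less_iff)
      thus ?thesis by (simp add: algebra_simps)
    qed
    also have "\<dots> \<le> 2 * (real A + 1) * m"
    proof (rule mult_right_mono)
      have "q \<le> m + 2 * (A + 1)"
        using A(2) by linarith
      hence "real q \<le> real (m + 2 * (A + 1))"
        by (simp only: of_nat_le_iff)
      thus "real q - real m \<le> 2 * (real A + 1)"
        by simp
    qed simp
    finally have "2 * (real \<mu> * \<mu>) * (2 * real m - 1) < 2 * (real A + 1) * m" .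
    hence less: "2 * \<mu> * (real A + 1) + 2 * (real \<mu> * \<mu>) * (2 * real m - 1)
        < 2 * \<mu> * (real A + 1) + 2 * (real A + 1) * m"
      by (rule add_strict_left_mono)
    have "real (2 * \<mu> * (A + J + (m - 1) * (2 * \<mu> - 1) + 1))
        = 2 * \<mu> * (real A + 1) + 2 * (real \<mu> * \<mu>) * (2 * real m - 1)"
      unfolding of_nat_mult of_nat_add diffs of_nat_numeral of_nat_1 by algebra
    also note less
    also have "2 * \<mu> * (real A + 1) + 2 * (real A + 1) * m = real (2 * ((A + 1) * (J + 1)))"
      unfolding of_nat_mult of_nat_add diffs of_nat_numeral of_nat_1 by algebra
    finally have "real (2 * \<mu> * (A + J + (m - 1) * (2 * \<mu> - 1) + 1))
        < real (2 * ((A + 1) * (J + 1)))" .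
    thus ?thesis by (simp only: of_nat_less_iff)
  qed
  obtain h0 h1 :: "'a poly poly" where h: "h0 \<noteq> 0 \<or> h1 \<noteq> 0" "degree h0 \<le> J" "degree h1 \<le> J"
      "\<And>j. degree (coeff h0 j) \<le> A" "\<And>j. degree (coeff h1 j) \<le> A"
    and dvd: "\<And>x. poly f x \<noteq> 0 \<Longrightarrow> poly f x ^ c = \<epsilon> \<Longrightarrow>
       [:-x, 1:] ^ (2 * \<mu>) dvd poly h0 (monom 1 CARD('a)) + f ^ c * poly h1 (monom 1 CARD('a))"
    using ex_vanishing_pair[of f "2 * \<mu>" A J c \<epsilon>] m1 M count unfolding f q_def by blast
  define R where "R = poly h0 (monom 1 CARD('a)) + f ^ c * poly h1 (monom 1 CARD('a))"
  have "2 * A + card S < CARD('a)"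
    using A(1) mq(1) unfolding q_def m_def by linarith
  hence "R \<noteq> 0"
    unfolding R_def f_def c_def q_def using S q h by (intro auxiliary_poly_nonzero) auto
  hence "2 * \<mu> * card T \<le> degree R"
    using dvd by (intro mult_card_le_degree) (auto simp: T_def R_def)
  also have "degree R \<le> c * m + (A + q * J)"
    unfolding R_def
  proof (rule degree_add_le)
    show "degree (poly h0 (monom 1 CARD('a))) \<le> c * m + (A + q * J)"
      unfolding q_def by (rule trans_le_add2[OF degree_poly_at_monom_le]) (use h in auto)
    have "degree (f ^ c) \<le> c * m"
      using degree_power_le[of f c] by (simp add: f mult.commute)
    moreover have "degree (poly h1 (monom 1 CARD('a))) \<le> A + q * J"
      unfolding q_def by (rule degree_poly_at_monom_le) (use h in auto)
    ultimately show "degree (f ^ c * poly h1 (monom 1 CARD('a))) \<le> c * m + (A + q * J)"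
      by (intro order_trans[OF degree_mult_le]) (rule add_mono)
  qed
  finally have "real (2 * \<mu> * card T) \<le> real (c * m + (A + q * J))"
    by (simp only: of_nat_le_iff)
  hence "2 * (real \<mu> * card T) \<le> real c * m + A + (real q * \<mu> + real q * m - real q)"
    unfolding of_nat_add of_nat_mult diffs of_nat_numeral ring_distribs by simp
  moreover have "2 * (real c * m) \<le> real q * m - m"
  proof -
    have "2 * real c \<le> real q - 1"
      using mq(1) unfolding c_def by linarith
    from mult_right_mono[OF this, of "real m"] show ?thesis
      by (simp add: left_diff_distrib)
  qed
  moreover have "2 * real A \<le> real q - 1 - m"
    using A mq by linarith
  ultimately have "4 * (real \<mu> * card T) \<le> 2 * (real q * \<mu>) + 3 * (real q * m) - real q"
    by linarith
  also have "\<dots> = real (2 * q * \<mu> + q * (3 * m - 1))"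
    unfolding of_nat_mult of_nat_add diffs of_nat_numeral by algebra
  finally have "real (4 * \<mu> * card T) \<le> real (2 * q * \<mu> + q * (3 * m - 1))"
    by simp
  thus ?thesis
    unfolding T_def q_def m_def c_def by (simp only: of_nat_le_iff)
qed

section \<open>The quadratic character and its sums\<close>

definition qchar :: "'a::{field,finite} \<Rightarrow> real" where
  "qchar x = (if x = 0 then 0 else if x ^ ((CARD('a) - 1) div 2) = 1 then 1 else -1)"

lemma qchar_values: "qchar x \<in> {0, 1, -1}"
  by (simp add: qchar_def)

lemma qchar_eq_0_iff [simp]: "qchar x = 0 \<longleftrightarrow> x = 0"
  by (simp add: qchar_def)

lemma power_card_minus_1:
  fixes x :: "'a::{field,finite}"
  assumes "x \<noteq> 0"
  shows "x ^ (CARD('a) - 1) = 1"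
proof -
  have "x * x ^ (CARD('a) - 1) = x * 1"
    using power_card_field[of x] power_Suc[of x "CARD('a) - 1"] by simp
  thus ?thesis using assms by simp
qed

lemma euler_power_cases:
  fixes x :: "'a::{field,finite}"
  assumes "odd CARD('a)" "x \<noteq> 0"
  shows "x ^ ((CARD('a) - 1) div 2) = 1 \<or> x ^ ((CARD('a) - 1) div 2) = -1"
proof -
  have "(x ^ ((CARD('a) - 1) div 2))\<^sup>2 = 1"
    using assms power_card_minus_1[of x] by (simp flip: power_mult)
  thus ?thesis by (simp add: power2_eq_1_iff)
qed

text \<open>
  Translating by \<open>1\<close> permutes the field, so \<open>q\<close> times \<open>1\<close> is \<open>0\<close>; in characteristic two this would
  make \<open>1 = 0\<close> for odd \<open>q\<close>.
\<close>

lemma one_neq_minus_one: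
  assumes "odd CARD('a::{field,finite})"
  shows "(1::'a) \<noteq> -1"
proof
  assume 1: "(1::'a) = -1"
  have "(\<Sum>x\<in>UNIV. x) = (\<Sum>x\<in>UNIV. x + 1 :: 'a)"
    by (rule sum.reindex_bij_witness[of _ "\<lambda>x. x + 1" "\<lambda>x. x - 1"]) auto
  hence "of_nat CARD('a) = (0::'a)"
    by (simp add: sum.distrib)
  moreover obtain k where "CARD('a) = 2 * k + 1"
    using assms by (elim oddE)
  moreover have "(2::'a) = 0"
    using 1 by (metis add.right_inverse one_add_one)
  ultimately show False by simp
qed

lemma qchar_mult:
  fixes x y :: "'a::{field,finite}"
  assumes "odd CARD('a)"
  shows "qchar (x * y) = qchar x * qchar y"
proof (cases "x = 0 \<or> y = 0")
  case False
  thus ?thesis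
    using euler_power_cases[OF assms, of x] euler_power_cases[OF assms, of y] one_neq_minus_one[OF assms]
    by (auto simp: qchar_def power_mult_distrib)
qed (auto simp: qchar_def)

lemma qchar_prod:
  fixes g :: "'i \<Rightarrow> 'a::{field,finite}"
  assumes "odd CARD('a)"
  shows "qchar (\<Prod>i\<in>I. g i) = (\<Prod>i\<in>I. qchar (g i))"
  by (induction I rule: infinite_finite_induct) (simp_all add: qchar_mult[OF assms], simp_all add: qchar_def)

lemma qchar_square:
  fixes x :: "'a::{field,finite}"
  assumes "odd CARD('a)" "x \<noteq> 0"
  shows "qchar (x\<^sup>2) = 1"
  using assms power_card_minus_1[of x] by (simp add: qchar_def flip: power_mult)

lemma sum_qchar_conv_card:
  fixes g :: "'b::finite \<Rightarrow> 'a::{field,finite}"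
  defines "c \<equiv> (CARD('a) - 1) div 2"
  assumes "odd CARD('a)"
  shows "(\<Sum>v\<in>UNIV. qchar (g v)) =
           real (card {v. g v \<noteq> 0 \<and> g v ^ c = 1}) - real (card {v. g v \<noteq> 0 \<and> g v ^ c = -1})"
    and "card {v. g v \<noteq> 0 \<and> g v ^ c = 1} + card {v. g v \<noteq> 0 \<and> g v ^ c = -1} + card {v. g v = 0} = CARD('b)"
proof -
  let ?P = "{v. g v \<noteq> 0 \<and> g v ^ c = 1}" and ?N = "{v. g v \<noteq> 0 \<and> g v ^ c = -1}" and ?Z = "{v. g v = 0}"
  have "UNIV = ?P \<union> ?N \<union> ?Z"
    using euler_power_cases[OF assms(2)] unfolding c_def by auto
  hence "sum h UNIV = sum h (?P \<union> ?N \<union> ?Z)" for h :: "'b \<Rightarrow> real"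
    by (rule arg_cong)
  moreover have "?P \<inter> ?N = {}" "(?P \<union> ?N) \<inter> ?Z = {}"
    using one_neq_minus_one[OF assms(2)] by auto
  ultimately have split: "(\<Sum>v\<in>UNIV. h v) = sum h ?P + sum h ?N + sum h ?Z" for h :: "'b \<Rightarrow> real"
    by (simp only: sum.union_disjoint finite)
  have "sum (\<lambda>v. qchar (g v)) ?P = (\<Sum>v\<in>?P. 1)"
    by (rule sum.cong) (auto simp: qchar_def c_def)
  moreover have "sum (\<lambda>v. qchar (g v)) ?N = (\<Sum>v\<in>?N. -1)"
    using one_neq_minus_one[OF assms(2)] by (intro sum.cong) (auto simp: qchar_def c_def)
  moreover have "sum (\<lambda>v. qchar (g v)) ?Z = 0"
    by simp
  ultimately show "(\<Sum>v\<in>UNIV. qchar (g v)) = real (card ?P) - real (card ?N)"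
    unfolding split by simp
  show "card ?P + card ?N + card ?Z = CARD('b)"
    using split[of "\<lambda>_. 1"] by (simp flip: of_nat_add)
qed

text \<open>
  Each of the \<open>q - 1\<close> nonzero elements is a root of \<open>X\<^sup>c - 1\<close> or of \<open>X\<^sup>c + 1\<close> with \<open>c = (q - 1) / 2\<close>,
  and each of these two polynomials has at most \<open>c\<close> roots; hence both have exactly \<open>c\<close>.
\<close>

lemma sum_qchar:
  assumes q: "odd CARD('a::{field,finite})"
  shows "(\<Sum>v\<in>UNIV. qchar (v - a :: 'a)) = 0"
proof -
  let ?q = "CARD('a)" and ?c = "(CARD('a) - 1) div 2"
  have "?q > 1"
    using card_mono[of UNIV "{0, 1::'a}"] by simp
  hence c: "?c > 0" "2 * ?c + 1 = ?q"
    using q by presburger+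
  have le: "card {x::'a. x \<noteq> 0 \<and> x ^ ?c = e} \<le> ?c" if "e \<noteq> 0" for e
  proof -
    have "coeff (monom 1 ?c - [:e:]) ?c \<noteq> 0"
      using c by (simp add: coeff_pCons split: nat.split)
    hence nz: "monom 1 ?c - [:e:] \<noteq> 0"
      by (metis coeff_0)
    have "card {x::'a. x \<noteq> 0 \<and> x ^ ?c = e} \<le> card {x. poly (monom 1 ?c - [:e:]) x = 0}"
      by (intro card_mono) (auto simp: poly_monom)
    also have "\<dots> \<le> degree (monom 1 ?c - [:e:])"
      by (rule card_poly_roots_bound[OF nz])
    also have "\<dots> \<le> ?c"
      by (intro degree_diff_le) (auto simp: degree_monom_le)
    finally show ?thesis .
  qed
  have "card {v::'a. v = 0} = 1" by simp
  hence "card {x::'a. x \<noteq> 0 \<and> x ^ ?c = 1} = card {x::'a. x \<noteq> 0 \<and> x ^ ?c = -1}"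
    using le[of 1] le[of "-1"] sum_qchar_conv_card(2)[OF q, of "\<lambda>v. v"] c by simp
  hence "(\<Sum>v\<in>UNIV. qchar (v :: 'a)) = 0"
    using sum_qchar_conv_card(1)[OF q, of "\<lambda>v. v"] by simp
  also have "(\<Sum>v\<in>UNIV. qchar (v :: 'a)) = (\<Sum>v\<in>UNIV. qchar (v - a))"
    by (rule sum.reindex_bij_witness[of _ "\<lambda>v. v - a" "\<lambda>v. v + a"]) auto
  finally show ?thesis .
qed

text \<open>
  Stepanov's method bounds both the number of \<open>v\<close> with value \<open>1\<close> and the number of those with value
  \<open>-1\<close> from above. Since the two numbers add up to \<open>q\<close> minus the number of roots, each upper bound
  is a lower bound for the other number.
\<close>

lemma character_sum_bound:
  fixes S :: "'a::{field,finite} set"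
  assumes "S \<noteq> {}" "odd CARD('a)" "\<mu> \<ge> 1" "4 * \<mu>\<^sup>2 \<le> CARD('a)" "2 * (card S)\<^sup>2 < CARD('a)"
  shows "\<bar>\<Sum>v\<in>UNIV. \<Prod>a\<in>S. qchar (v - a)\<bar>
           \<le> real CARD('a) * (3 * card S - 1) / (2 * \<mu>) + card S"
proof -
  define f where "f = (\<Prod>a\<in>S. [:-a, 1:])"
  define q c m where "q = CARD('a)" and "c = (CARD('a) - 1) div 2" and "m = card S"
  define N where "N e = card {v. poly f v \<noteq> 0 \<and> poly f v ^ c = e}" for e
  have m: "m \<ge> 1"
    using assms(1) by (simp add: m_def Suc_le_eq card_gt_0_iff)
  have f: "poly f v = (\<Prod>a\<in>S. v - a)" for v
    by (simp add: f_def poly_prod)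
  have "f \<noteq> 0" "degree f = m"
    by (simp_all add: f_def m_def degree_prod_eq_sum_degree)
  hence roots: "card {v. poly f v = 0} \<le> m"
    using card_poly_roots_bound[of f] by simp
  have sum: "(\<Sum>v\<in>UNIV. \<Prod>a\<in>S. qchar (v - a)) = real (N 1) - real (N (-1))"
    using sum_qchar_conv_card(1)[OF assms(2), of "poly f"]
    by (simp add: f qchar_prod[OF assms(2)] N_def c_def)
  have total: "N 1 + N (-1) + card {v. poly f v = 0} = q"
    using sum_qchar_conv_card(2)[OF assms(2), of "poly f"] by (simp add: N_def c_def q_def)
  have upper: "real (N e) \<le> q / 2 + q * (3 * real m - 1) / (4 * \<mu>)" for e
  proof -
    have "real (4 * \<mu> * N e) \<le> real (2 * q * \<mu> + q * (3 * m - 1))"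
      using stepanov_bound[OF assms, of e]
      by (simp only: of_nat_le_iff N_def f_def q_def c_def m_def)
    thus ?thesis
      using assms(3) m by (simp add: field_simps of_nat_diff)
  qed
  have "\<bar>real (N 1) - real (N (-1))\<bar> \<le> 2 * (q * (3 * real m - 1) / (4 * \<mu>)) + m"
    using upper[of 1] upper[of "-1"] total roots by linarith
  also have "2 * (q * (3 * real m - 1) / (4 * \<mu>)) = q * (3 * real m - 1) / (2 * \<mu>)"
    by simp
  finally show ?thesis
    using m by (simp add: sum q_def m_def of_nat_diff)
qed

text \<open>
  There are \<open>2\<^sup>n - 1 - n\<close> subsets with at least two elements. The singletons are kept out because
  they contribute exactly \<open>0\<close>; bounding them like the others would make the estimate too weak for
  two or three elements in \<open>exists_qchar_eq_minus_1\<close>.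
\<close>

lemma sum_character_products_bound:
  fixes B :: "'a::{field,finite} set"
  assumes q: "odd CARD('a)" and \<mu>: "\<mu> \<ge> 1" "4 * \<mu>\<^sup>2 \<le> CARD('a)" and n: "2 * (card B)\<^sup>2 < CARD('a)" "B \<noteq> {}"
  shows "real CARD('a) - (2 ^ card B - 1 - real (card B)) *
             (real CARD('a) * (3 * real (card B) - 1) / (2 * \<mu>) + card B)
           \<le> (\<Sum>v\<in>UNIV. \<Prod>a\<in>B. 1 - qchar (v - a))"
proof -
  let ?q = "real CARD('a)" and ?n = "real (card B)"
  define K where "K = ?q * (3 * ?n - 1) / (2 * \<mu>) + ?n"
  define \<sigma> where "\<sigma> S = (\<Sum>v\<in>UNIV. \<Prod>a\<in>S. - qchar (v - a))" for S :: "'a set"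
  have "(\<Sum>v\<in>UNIV. \<Prod>a\<in>B. 1 - qchar (v - a)) = (\<Sum>v\<in>UNIV. \<Sum>S\<in>Pow B. \<Prod>a\<in>S. - qchar (v - a))"
    using prod_add[of B "\<lambda>a. - qchar (_ - a)" "\<lambda>_. 1"] by simp
  also have "\<dots> = (\<Sum>S\<in>Pow B. \<sigma> S)"
    unfolding \<sigma>_def by (rule sum.swap)
  also have "\<dots> = (\<Sum>S\<in>insert {} ((\<lambda>a. {a}) ` B). \<sigma> S) + (\<Sum>S\<in>Pow B - insert {} ((\<lambda>a. {a}) ` B). \<sigma> S)"
    by (subst add.commute, rule sum.subset_diff) auto
  also have "(\<Sum>S\<in>insert {} ((\<lambda>a. {a}) ` B). \<sigma> S) = ?q"
  proof -
    have "\<sigma> {a} = 0" for a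
      using sum_qchar[OF q, of a] by (simp add: \<sigma>_def sum_negf)
    hence "(\<Sum>S\<in>(\<lambda>a. {a}) ` B. \<sigma> S) = 0"
      by (intro sum.neutral) auto
    moreover have "\<sigma> {} = ?q"
      by (simp add: \<sigma>_def)
    ultimately show ?thesis
      by (subst sum.insert) auto
  qed
  finally have eq: "(\<Sum>v\<in>UNIV. \<Prod>a\<in>B. 1 - qchar (v - a)) = 
      ?q + (\<Sum>S\<in>Pow B - insert {} ((\<lambda>a. {a}) ` B). \<sigma> S)" .
  have "\<bar>\<Sum>S\<in>Pow B - insert {} ((\<lambda>a. {a}) ` B). \<sigma> S\<bar> \<le> (\<Sum>S\<in>Pow B - insert {} ((\<lambda>a. {a}) ` B). K)"
  proof (rule order_trans[OF sum_abs], rule sum_mono)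
    fix S assume S: "S \<in> Pow B - insert {} ((\<lambda>a. {a}) ` B)"
    hence card: "card S \<le> card B" "S \<noteq> {}" by (auto intro: card_mono)
    have "\<sigma> S = (\<Sum>v\<in>UNIV. (-1) ^ card S * (\<Prod>a\<in>S. qchar (v - a)))"
      by (simp add: \<sigma>_def prod_uminus)
    hence "\<bar>\<sigma> S\<bar> = \<bar>\<Sum>v\<in>UNIV. \<Prod>a\<in>S. qchar (v - a)\<bar>"
      by (simp add: abs_mult flip: sum_distrib_left)
    also have "\<dots> \<le> ?q * (3 * card S - 1) / (2 * \<mu>) + card S"
    proof (rule character_sum_bound)
      show "2 * (card S)\<^sup>2 < CARD('a)"
        using card n by (meson le_less_trans mult_le_mono2 power_mono zero_le)
    qed (use card q \<mu> in auto)
    also have "\<dots> \<le> K"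
    proof -
      have "real (3 * card S - 1) \<le> 3 * ?n - 1"
        using card by (cases "card S") (auto simp: card_eq_0_iff)
      thus ?thesis
        unfolding K_def using card by (intro add_mono divide_right_mono mult_left_mono) auto
    qed
    finally show "\<bar>\<sigma> S\<bar> \<le> K" .
  qed
  also have "\<dots> = (2 ^ card B - 1 - ?n) * K"
  proof -
    have "card (insert {} ((\<lambda>a. {a}) ` B)) = 1 + card B"
      by (subst card_insert_disjoint) (auto simp: card_image inj_on_def)
    moreover have "card (Pow B) = card (insert {} ((\<lambda>a. {a}) ` B))
        + card (Pow B - insert {} ((\<lambda>a. {a}) ` B))"
      by (subst card_Un_disjoint [symmetric]) (auto intro!: arg_cong[of _ _ card])
    ultimately have "real (2 ^ card B) = 1 + ?n + real (card (Pow B - insert {} ((\<lambda>a. {a}) ` B)))"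
      by (simp add: card_Pow flip: of_nat_add)
    hence "real (card (Pow B - insert {} ((\<lambda>a. {a}) ` B))) = 2 ^ card B - (1 + ?n)"
      by simp
    thus ?thesis by simp
  qed
  finally show ?thesis
    unfolding eq K_def [symmetric] by linarith
qed

section \<open>Elements with prescribed non-square differences\<close>

lemma subset_count_bound:
  fixes n :: nat
  assumes "n \<ge> 2"
  shows "(2 ^ n - 1 - real n) * (3 * real n - 1) \<le> 3 / 4 * (n * 4 ^ (n - 1))"
proof -
  consider "n = 2" | "n = 3" | "n \<ge> 4" using assms by linarith
  thus ?thesis
  proof cases
    case 3
    have "(2::real) ^ 4 \<le> 2 ^ n"
      using 3 by (rule power_increasing) auto
    hence "2 ^ n * 16 \<le> (2::real) ^ n * 2 ^ n"
      by (intro mult_left_mono) auto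
    also have "\<dots> = 4 ^ n"
      by (simp flip: power_mult_distrib)
    also have "\<dots> = 4 * 4 ^ (n - 1)"
      using assms by (simp flip: power_Suc)
    finally have 4: "4 * 2 ^ n \<le> (4::real) ^ (n - 1)" by simp
    have "(2 ^ n - 1 - real n) * (3 * real n - 1) \<le> 2 ^ n * (3 * real n)"
      using assms by (intro mult_mono) auto
    also have "\<dots> \<le> 3 / 4 * (n * 4 ^ (n - 1))"
      using mult_left_mono[OF 4, of "3 / 4 * real n"] by simp
    finally show ?thesis .
  qed auto
qed

text \<open>
  With \<open>2 \<mu> = n 4\<^bsup>n-1\<^esup>\<close> the hypothesis is exactly \<open>4 \<mu>\<^sup>2 < q\<close>, and the character sums take away at
  most \<open>3/4 q\<close> from the main term (\<open>subset_count_bound\<close>) besides terms \<open>O (n 2\<^sup>n)\<close>. The case \<open>n = 1\<close>,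
  in which \<open>\<mu>\<close> would not be an integer, involves only the sum of \<open>\<chi>\<close> over the whole field.
\<close>

lemma exists_qchar_eq_minus_1:
  fixes B :: "'a::{field,finite} set"
  assumes q: "odd CARD('a)" and B: "B \<noteq> {}"
    and large: "(card B)\<^sup>2 * 2 ^ (4 * card B - 4) < CARD('a)"
  shows "\<exists>v. \<forall>a\<in>B. qchar (v - a) = -1"
proof (rule ccontr)
  assume none: "\<not> ?thesis"
  let ?q = "CARD('a)"
  define n where "n = card B"
  have "?q > 1"
    using card_mono[of UNIV "{0, 1::'a}"] by simp
  hence q3: "?q \<ge> 3"
    using q by presburger
  have "n \<ge> 1"
    using B by (simp add: n_def Suc_le_eq card_gt_0_iff)
  have zero: "(\<Prod>a\<in>B. 1 - qchar (v - a)) = 0" if "v \<notin> B" for v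
  proof -
    obtain a where a: "a \<in> B" "qchar (v - a) \<noteq> -1"
      using none by blast
    hence "qchar (v - a) = 1"
      using that qchar_values[of "v - a"] by auto
    thus ?thesis using a by (intro prod_zero) auto
  qed
  have "(\<Sum>v\<in>UNIV. \<Prod>a\<in>B. 1 - qchar (v - a)) = (\<Sum>v\<in>B. \<Prod>a\<in>B. 1 - qchar (v - a))"
    by (rule sum.mono_neutral_right) (auto simp: zero)
  also have "\<dots> \<le> (\<Sum>v\<in>B. 2 ^ n)"
  proof (rule sum_mono)
    fix v :: 'a
    have "0 \<le> 1 - qchar (v - a) \<and> 1 - qchar (v - a) \<le> 2" for a
      by (simp add: qchar_def)
    hence "(\<Prod>a\<in>B. 1 - qchar (v - a)) \<le> (\<Prod>a\<in>B. 2)"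
      by (intro prod_mono) auto
    thus "(\<Prod>a\<in>B. 1 - qchar (v - a)) \<le> 2 ^ n"
      by (simp add: n_def)
  qed
  finally have upper: "(\<Sum>v\<in>UNIV. \<Prod>a\<in>B. 1 - qchar (v - a)) \<le> n * 2 ^ n"
    by (simp add: n_def)
  show False
  proof (cases "n = 1")
    case True
    then obtain b where "B = {b}"
      by (auto simp: n_def card_1_singleton_iff)
    hence "(\<Sum>v\<in>UNIV. \<Prod>a\<in>B. 1 - qchar (v - a)) = real ?q"
      by (simp add: sum_subtractf sum_qchar[OF q])
    thus False using upper q3 True by simp
  next
    case False
    hence n: "n \<ge> 2" using \<open>n \<ge> 1\<close> by simp
    define \<mu> where "\<mu> = n * 2 ^ (2 * n - 3)"
    have "Suc (2 * n - 3) = 2 * (n - 1)"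
      using n by simp
    hence "2 * 2 ^ (2 * n - 3) = (2::nat) ^ (2 * (n - 1))"
      by (metis power_Suc)
    hence \<mu>: "2 * \<mu> = n * 4 ^ (n - 1)"
      by (simp add: \<mu>_def power_mult)
    have "4 * \<mu>\<^sup>2 = (2 * \<mu>)\<^sup>2" by (simp add: power2_eq_square)
    also have "\<dots> = n\<^sup>2 * (4 ^ 2) ^ (n - 1)"
      unfolding \<mu> power_mult_distrib by (metis power_mult mult.commute)
    also have "\<dots> = n\<^sup>2 * 2 ^ (4 * (n - 1))"
      unfolding power_mult by simp
    also have "4 * (n - 1) = 4 * n - 4"
      by simp
    finally have sq: "4 * \<mu>\<^sup>2 = n\<^sup>2 * 2 ^ (4 * n - 4)" .
    have "(2::nat) ^ 4 \<le> 2 ^ (4 * n - 4)"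
      using n by (intro power_increasing) auto
    hence "n\<^sup>2 * 2 \<le> n\<^sup>2 * 2 ^ (4 * n - 4)"
      by (intro mult_left_mono) auto
    hence small: "2 * n\<^sup>2 < ?q"
      using large unfolding n_def by linarith
    have "\<mu> \<ge> 1" using n by (simp add: \<mu>_def)
    define D where "D = 2 ^ n - 1 - real n"
    have "D \<ge> 0"
      unfolding D_def using n
    proof (induction n rule: dec_induct)
      case (step k)
      thus ?case by simp
    qed simp
    have "D \<le> 2 ^ n" by (simp add: D_def)
    define K where "K = ?q * (3 * real n - 1) / (2 * \<mu>)"
    have "real ?q - D * (K + n) \<le> n * 2 ^ n"
      using sum_character_products_bound[OF q \<open>\<mu> \<ge> 1\<close>, of B] upper small B sq large
      by (simp add: n_def D_def K_def)
    moreover have "D * K \<le> 3 / 4 * ?q"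
    proof -
      have "D * (3 * real n - 1) \<le> 3 / 4 * (2 * real \<mu>)"
        using subset_count_bound[OF n] \<mu> unfolding D_def by (metis of_nat_mult of_nat_numeral of_nat_power)
      hence "?q * (D * (3 * real n - 1)) \<le> ?q * (3 / 4 * (2 * real \<mu>))"
        by (rule mult_left_mono) simp
      thus ?thesis using \<open>\<mu> \<ge> 1\<close> by (simp add: K_def field_simps)
    qed
    moreover have "D * n \<le> n * 2 ^ n"
      using \<open>D \<le> 2 ^ n\<close> mult_right_mono[of D "2 ^ n" "real n"] by (simp add: mult.commute)
    \<comment> \<open>A quarter of the main term is left over against two error terms \<open>n 2\<^sup>n\<close>.\<close>
    ultimately have "real ?q \<le> 8 * (n * 2 ^ n)"
      unfolding distrib_left by linarith
    hence "?q \<le> 8 * (n * 2 ^ n)"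
      by (metis of_nat_le_iff of_nat_mult of_nat_numeral of_nat_power)
    also have "\<dots> = n * 2 ^ (n + 3)" by (simp add: power_add)
    also have "\<dots> \<le> n * 2 ^ (1 + (4 * n - 4))"
      using n by (intro mult_left_mono power_increasing) auto
    also have "\<dots> \<le> n * (n * 2 ^ (4 * n - 4))"
      using n by simp
    also have "\<dots> < ?q"
      using large by (simp add: n_def power2_eq_square mult.assoc)
    finally show False by simp
  qed
qed

theorem theorem2p1:
  fixes p k q n :: nat
    and a :: "nat \<Rightarrow> 'a::{field,finite}"
  assumes "prime p" and "odd p" and "k \<ge> 1" and "q = p ^ k"
    and "CARD('a) = q"
    and "n \<ge> 1"
    and "n\<^sup>2 * 2 ^ (4 * n - 4) < q"
    and "inj_on a {1..n}"
  shows "\<exists>v. is_leaf (with_proj (poly_digraph n (\<lambda>i. monom 1 2 + [:a i:]))) v"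
proof -
  have odd: "odd CARD('a)"
    using assms by simp
  have "card (a ` {1..n}) = n"
    using assms(8) by (simp add: card_image)
  hence "\<exists>v. \<forall>b\<in>a ` {1..n}. qchar (v - b) = -1"
    using assms by (intro exists_qchar_eq_minus_1[OF odd]) auto
  then obtain v where v: "\<And>i. i \<in> {1..n} \<Longrightarrow> qchar (v - a i) = -1"
    by blast
  have none: "u\<^sup>2 + a i \<noteq> v" if "i \<in> {1..n}" for u i
  proof
    assume "u\<^sup>2 + a i = v"
    hence "qchar (u\<^sup>2) = -1"
      using v[OF that] by auto
    thus False
      using qchar_square[OF odd, of u] by (cases "u = 0") (auto simp: qchar_def)
  qed
  have "e \<notin> in_arcs (with_proj (poly_digraph n (\<lambda>i. monom 1 2 + [:a i:]))) v" for e
  proof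
    assume "e \<in> in_arcs (with_proj (poly_digraph n (\<lambda>i. monom 1 2 + [:a i:]))) v"
    then obtain i where "i \<in> {1..n}" "(fst e)\<^sup>2 + a i = v"
      by (auto simp: in_arcs_def poly_digraph_def poly_monom)
    thus False
      using none by blast
  qed
  hence "in_arcs (with_proj (poly_digraph n (\<lambda>i. monom 1 2 + [:a i:]))) v = {}"
    by blast
  thus ?thesis
    by (auto simp: is_leaf_def in_degree_def poly_digraph_def)
qed

end
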